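(* Let $P$ be a finite poset with $|P|\ge 2$, and let $C_P$ be a constant and $n_0$ a positive integer such that $\mathrm{La}^*(n,P)\leq C_P\binom{n}{\lfloor n/2\rfloor}$ for all $n\ge n_0$. Then there exists $n_1$ such that for all $n\geq n_1$, the number of induced $P$-free families in the Boolean lattice $2^{[n]}$ satisfies $$\mathrm{forb}^*(n,P)\leq \exp\left(490\,\frac{|P|^2}{\log_2 |P|}\,C_P\binom{n}{\lfloor n/2\rfloor}\right).$$
   Context: $[n]=\{1,\dots,n\}$, and $2^{[n]}$ is the power set of $[n]$ partially ordered by inclusion. $|P|$ is the number of elements of $P$. A poset $Q$ contains an induced copy of a finite poset $P$ if there is an injective map $f:P\to Q$ such that $f(x)<_Q f(y)$ if and only if $x<_P y$. A family $\mathcal F\subseteq 2^{[n]}$ is induced $P$-free if it contains no induced copy of $P$. $\mathrm{La}^*(n,P)$ is the largest size of an induced $P$-free family $\mathcal F\subseteq 2^{[n]}$, and $\mathrm{forb}^*(n,P)$ is the number of induced $P$-free families $\mathcal F\subseteq 2^{[n]}$. *)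

theory Defs
  imports Complex_Main
begin

text \<open>
  Posets are sets of elements of a partially ordered type, with the order inherited from the
  type; on set types the order \<open>\<le>\<close> is inclusion and \<open><\<close> is proper inclusion.
\<close>

definition contains_induced_copy :: "'b::order set \<Rightarrow> 'a::order set \<Rightarrow> bool" where
  "contains_induced_copy Q P \<longleftrightarrow>
     (\<exists>f. inj_on f P \<and> f ` P \<subseteq> Q \<and> (\<forall>x\<in>P. \<forall>y\<in>P. f x < f y \<longleftrightarrow> x < y))"

definition induced_free_families :: "nat \<Rightarrow> 'a::order set \<Rightarrow> nat set set set" where
  "induced_free_families n P = {F. F \<subseteq> Pow {1..n} \<and> \<not> contains_induced_copy F P}"

text \<open>
  For nonempty \<open>P\<close> the maximum is taken over a nonempty finite set, as the empty family is
  induced \<open>P\<close>-free.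
\<close>

definition La_star :: "nat \<Rightarrow> 'a::order set \<Rightarrow> nat" where
  "La_star n P = Max (card ` induced_free_families n P)"

definition forb_star :: "nat \<Rightarrow> 'a::order set \<Rightarrow> nat" where
  "forb_star n P = card (induced_free_families n P)"

end

theory Submission
  imports Defs "HOL-Combinatorics.Permutations" "HOL-Library.FuncSet" "HOL-Real_Asymp.Real_Asymp"
begin

text \<open>
  Write \<open>N\<^sub>n\<close> for the binomial coefficient \<open>n choose (n div 2)\<close>.  An induced \<open>P\<close>-free family \<open>F\<close> is
  encoded by permuting the ground set with some \<open>\<sigma>\<close> and then forgetting its last points one after the
  other.  Let \<open>T\<^sub>j\<close> be the trace of the permuted family on \<open>{1..n-j}\<close>.  A member of \<open>T\<^sub>j\<close> comes from a
  member of \<open>T\<^sub>j\<^sub>-\<^sub>1\<close> without the forgotten point, from one with it, or from both; so \<open>T\<^sub>j\<close> has at most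
  \<open>3 ^ card T\<^sub>j\<close> predecessors, and \<open>F\<close> is determined by \<open>\<sigma>\<close>, by \<open>T\<^sub>r\<close>, and by a ternary word of length
  \<open>card T\<^sub>1 + \<dots> + card T\<^sub>r\<close>.  With \<open>r\<close> about \<open>2 * log 2 n\<close> there are \<open>exp (o N\<^sub>n)\<close> choices of \<open>\<sigma>\<close>
  and of \<open>T\<^sub>r\<close>, so all depends on finding \<open>\<sigma>\<close> for which the word has length \<open>O (C * N\<^sub>n)\<close>.

  A fixed \<open>\<sigma>\<close> may give \<open>card T\<^sub>j = card F\<close> for all \<open>j\<close> up to a multiple of \<open>log n\<close>, and then the
  word is too long by a factor of that order.  On average over \<open>\<sigma>\<close>, however, \<open>card T\<^sub>j\<close> is at most \<open>16 * (j+1) * C * N\<^sub>n\<^sub>-\<^sub>j\<close>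
  (\<open>sum_card_trace_le\<close>), and \<open>N\<^sub>n\<^sub>-\<^sub>j\<close> decays geometrically in \<open>j\<close>.  For the average, observe that \<open>A\<close>
  lies in \<open>T\<^sub>j\<close> iff the permuted family meets the interval from \<open>A\<close> to \<open>A \<union> {n-j<..n}\<close>, and that
  the number of \<open>\<sigma>\<close> for which this happens depends on \<open>card A\<close> alone.  Hence the \<open>A\<close> may be replaced by
  intervals placed more cleverly.  The lattice of subsets of \<open>{1..m}\<close>, with \<open>m\<close> about \<open>n / (j+1)\<close>, can be
  mapped to intervals \<open>[L S, U S]\<close> of length \<open>j\<close> in which \<open>S \<subset> T\<close> gives \<open>U S \<subseteq> L T\<close>, and
  \<open>L S \<subseteq> U T\<close> only if \<open>S \<subseteq> T\<close>.  Members of the family chosen from such intervals are ordered as the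
  indices \<open>S\<close> are, so the \<open>S\<close> whose interval is met form an induced \<open>P\<close>-free family
  (\<open>induced_free_interval_hits\<close>) of size at most \<open>C * N\<^sub>m\<close>.  The sets \<open>L S\<close> occupy every \<open>(j+1)\<close>-st
  level, and the \<open>j+1\<close> possible shifts together cover all levels.  It remains to see that the level sizes
  of the large cube, divided by \<open>N\<^sub>n\<^sub>-\<^sub>j\<close>, are dominated by those of the small cube, divided by \<open>N\<^sub>m\<close>
  (\<open>binomial_compare\<close>).

  Summing over \<open>j\<close> gives a word of length at most \<open>128 * C * N\<^sub>n\<close>, hence an exponent of
  \<open>258 * C * N\<^sub>n\<close>, which the factor \<open>490 * (p\<^sup>2 / log 2 p) \<ge> 490\<close>, with
  \<open>p = card P\<close>, dominates.
\<close>

section \<open>Families and their traces\<close>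

definition trace_on :: "'a set \<Rightarrow> 'a set set \<Rightarrow> 'a set set" where
  "trace_on V F = (\<lambda>X. X \<inter> V) ` F"

lemma trace_on_trace_on: "W \<subseteq> V \<Longrightarrow> trace_on W (trace_on V F) = trace_on W F"
  by (simp add: trace_on_def image_image Int_assoc Int_absorb1)

text \<open>
  The family is determined by recording, for each member \<open>g\<close> of the trace, which of \<open>g\<close> and
  \<open>insert x g\<close> belong to it: a nonempty set of two options, that is, three possibilities.
\<close>

lemma card_families_with_trace:
  assumes "finite V" "x \<notin> V" "G \<subseteq> Pow V"
  shows "card {F. F \<subseteq> Pow (insert x V) \<and> trace_on V F = G} \<le> 3 ^ card G"
proof -
  define \<Phi> where "\<Phi> F = (\<lambda>g\<in>G. {b. (if b then insert x g else g) \<in> F})" for F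
  let ?A = "{F. F \<subseteq> Pow (insert x V) \<and> trace_on V F = G}"
  let ?B = "G \<rightarrow>\<^sub>E (Pow (UNIV :: bool set) - {{}})"
  have fG: "finite G" using assms finite_subset by blast
  \<comment> \<open>Membership of \<open>X\<close> can be read off from the recorded options.\<close>
  have split: "X \<in> F \<longleftrightarrow> X \<inter> V \<in> G \<and> (x \<in> X) \<in> \<Phi> F (X \<inter> V)"
    if F: "F \<in> ?A" and X: "X \<subseteq> insert x V" for F X
  proof -
    have "(if x \<in> X then insert x (X \<inter> V) else X \<inter> V) = X" using X by auto
    moreover have "X \<in> F \<Longrightarrow> X \<inter> V \<in> G" using F by (auto simp: trace_on_def)
    ultimately show ?thesis by (auto simp: \<Phi>_def)
  qed
  have "inj_on \<Phi> ?A"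
  proof (rule inj_onI)
    fix F F' assume F: "F \<in> ?A" "F' \<in> ?A" and eq: "\<Phi> F = \<Phi> F'"
    have "X \<in> F \<longleftrightarrow> X \<in> F'" for X
    proof (cases "X \<subseteq> insert x V")
      case True
      then show ?thesis using split[OF F(1)] split[OF F(2)] eq by simp
    next
      case False
      then show ?thesis using F by blast
    qed
    then show "F = F'" by blast
  qed
  moreover have "\<Phi> ` ?A \<subseteq> ?B"
  proof
    fix h assume "h \<in> \<Phi> ` ?A"
    then obtain F where F: "F \<in> ?A" and h: "h = \<Phi> F" by blast
    have "\<Phi> F g \<noteq> {}" if "g \<in> G" for g
    proof -
      have "g \<in> trace_on V F" using F that by simp
      then obtain X where X: "X \<in> F" "X \<inter> V = g" unfolding trace_on_def by blast
      then have "(x \<in> X) \<in> \<Phi> F g" using split[OF F, of X] F by blast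
      then show ?thesis by blast
    qed
    then show "h \<in> ?B" by (auto simp: h \<Phi>_def)
  qed
  moreover have "finite ?B" using fG by (intro finite_PiE) auto
  ultimately have "card ?A \<le> card ?B" by (rule card_inj_on_le)
  also have "\<dots> = (\<Prod>g\<in>G. card (Pow (UNIV :: bool set) - {{}}))"
    by (rule card_PiE[OF fG])
  also have "card (Pow (UNIV :: bool set) - {{}}) = 3"
    by (subst card_Diff_subset) (simp_all only: card_Pow finite, simp_all)
  also have "(\<Prod>g\<in>G. 3) = 3 ^ card G" by simp
  finally show ?thesis .
qed

text \<open>
  This is the encoding by ternary words in the form of a Kraft inequality.  Each forgotten point costs a
  weight \<open>1/3\<close> per member of the trace, which exactly pays for the three possible preimages, so the
  total weight is bounded by the number of families on the \<open>n - r\<close> remaining points.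
\<close>

lemma sum_families_weighted_by_traces:
  assumes "r \<le> n"
  shows "(\<Sum>F\<in>Pow (Pow {1..n}). (1/3::real) ^ (\<Sum>j=1..r. card (trace_on {1..n-j} F))) \<le> 2 ^ (2 ^ (n-r))"
  using assms
proof (induction r arbitrary: n)
  case 0
  then show ?case by (simp add: card_Pow)
next
  case (Suc r)
  then obtain k where n: "n = Suc k" by (cases n) auto
  define w where "w k r F = (1/3::real) ^ (\<Sum>j=1..r. card (trace_on {1..k-j} F))" for k r and F :: "nat set set"
  let ?T = "trace_on {1..k}"
  have ins: "{1..n} = insert n {1..k}" using n by auto
  have fiber: "(\<Sum>F\<in>{F \<in> Pow (Pow {1..n}). ?T F = G}. w n (Suc r) F) \<le> w k r G"
    if G: "G \<in> Pow (Pow {1..k})" for G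
  proof -
    have w: "w n (Suc r) F = (1/3) ^ card G * w k r G" if "?T F = G" for F
    proof -
      have "(\<Sum>j=1..Suc r. card (trace_on {1..n-j} F))
          = card (trace_on {1..n-1} F) + (\<Sum>j=Suc 1..Suc r. card (trace_on {1..n-j} F))"
        by (rule sum.atLeast_Suc_atMost) simp
      also have "(\<Sum>j=Suc 1..Suc r. card (trace_on {1..n-j} F)) = (\<Sum>j=1..r. card (trace_on {1..k-j} G))"
        unfolding sum.shift_bounds_cl_Suc_ivl
        by (intro sum.cong refl) (simp add: n that[symmetric] trace_on_trace_on)
      finally show ?thesis using that by (simp add: w_def power_add n)
    qed
    have "(\<Sum>F\<in>{F \<in> Pow (Pow {1..n}). ?T F = G}. w n (Suc r) F)
        = real (card {F \<in> Pow (Pow {1..n}). ?T F = G}) * ((1/3) ^ card G * w k r G)"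
      by (simp add: w)
    also have "\<dots> \<le> 3 ^ card G * ((1/3) ^ card G * w k r G)"
    proof (rule mult_right_mono)
      have "card {F \<in> Pow (Pow {1..n}). ?T F = G} \<le> 3 ^ card G"
        using card_families_with_trace[of "{1..k}" n G] G n ins by simp
      then have "real (card {F \<in> Pow (Pow {1..n}). ?T F = G}) \<le> real (3 ^ card G)"
        by (rule of_nat_mono)
      then show "real (card {F \<in> Pow (Pow {1..n}). ?T F = G}) \<le> 3 ^ card G" by simp
    qed (simp add: w_def)
    also have "\<dots> = w k r G" by (simp add: power_divide)
    finally show ?thesis .
  qed
  have "(\<Sum>F\<in>Pow (Pow {1..n}). w n (Suc r) F)
      = (\<Sum>G\<in>Pow (Pow {1..k}). \<Sum>F\<in>{F \<in> Pow (Pow {1..n}). ?T F = G}. w n (Suc r) F)"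
    by (rule sum.group[symmetric]) (auto simp: trace_on_def)
  also have "\<dots> \<le> (\<Sum>G\<in>Pow (Pow {1..k}). w k r G)"
    by (rule sum_mono) (rule fiber)
  also have "\<dots> \<le> 2 ^ (2 ^ (k-r))"
    using Suc n by (simp add: w_def)
  finally show ?case by (simp add: w_def n)
qed

section \<open>Intervals hit by an induced free family\<close>

text \<open>
  Choose a member of \<open>F\<close> in each interval that is hit.  Both conditions on \<open>L\<close> and \<open>U\<close> are
  designed so that the inclusions between the chosen members are exactly those between the indices,
  wherever in the intervals the members lie; a copy of \<open>P\<close> among the indices is therefore carried to
  a copy in \<open>F\<close>.
\<close>

lemma induced_free_interval_hits:
  fixes L U :: "nat set \<Rightarrow> 'b set" and P :: "'a::order set"
  assumes free: "\<not> contains_induced_copy F P"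
    and above: "\<And>S T. S \<in> \<S> \<Longrightarrow> T \<in> \<S> \<Longrightarrow> S \<subset> T \<Longrightarrow> U S \<subseteq> L T"
    and apart: "\<And>S T. S \<in> \<S> \<Longrightarrow> T \<in> \<S> \<Longrightarrow> L S \<subseteq> U T \<Longrightarrow> S \<subseteq> T"
  shows "\<not> contains_induced_copy {S \<in> \<S>. \<exists>X\<in>F. L S \<subseteq> X \<and> X \<subseteq> U S} P"
proof
  assume "contains_induced_copy {S \<in> \<S>. \<exists>X\<in>F. L S \<subseteq> X \<and> X \<subseteq> U S} P"
  then obtain f where inj: "inj_on f P" and hit: "\<forall>x\<in>P. f x \<in> \<S> \<and> (\<exists>X\<in>F. L (f x) \<subseteq> X \<and> X \<subseteq> U (f x))"
    and ord: "\<forall>x\<in>P. \<forall>y\<in>P. f x < f y \<longleftrightarrow> x < y"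
    unfolding contains_induced_copy_def by (auto simp: image_subset_iff)
  from hit obtain h where h: "\<forall>x\<in>P. h x \<in> F \<and> L (f x) \<subseteq> h x \<and> h x \<subseteq> U (f x)"
    by metis
  have sub: "h x \<subseteq> h y \<longleftrightarrow> f x \<subseteq> f y" if "x \<in> P" "y \<in> P" for x y
  proof
    assume "h x \<subseteq> h y"
    then have "L (f x) \<subseteq> U (f y)" using h that by blast
    then show "f x \<subseteq> f y" using apart hit that by blast
  next
    assume le: "f x \<subseteq> f y"
    show "h x \<subseteq> h y"
    proof (cases "f x = f y")
      case True
      then show ?thesis using inj that by (auto dest: inj_onD)
    next
      case False
      then have "U (f x) \<subseteq> L (f y)" using above le hit that by blast
      then show ?thesis using h that by blast
    qed
  qed
  have "inj_on h P"
  proof (rule inj_onI)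
    fix x y assume "x \<in> P" "y \<in> P" "h x = h y"
    then show "x = y" using sub[of x y] sub[of y x] inj by (auto dest: inj_onD)
  qed
  moreover have "h ` P \<subseteq> F" using h by blast
  moreover have "\<forall>x\<in>P. \<forall>y\<in>P. h x < h y \<longleftrightarrow> x < y"
    using sub ord by (metis less_le_not_le)
  ultimately show False using free unfolding contains_induced_copy_def by blast
qed

lemma induced_free_image:
  fixes F :: "'b set set" and P :: "'a::order set"
  assumes free: "\<not> contains_induced_copy F P" and inj: "inj \<sigma>"
  shows "\<not> contains_induced_copy ((`) \<sigma> ` F) P"
proof
  assume "contains_induced_copy ((`) \<sigma> ` F) P"
  then obtain f where f: "inj_on f P" "f ` P \<subseteq> (`) \<sigma> ` F" "\<forall>x\<in>P. \<forall>y\<in>P. f x < f y \<longleftrightarrow> x < y"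
    unfolding contains_induced_copy_def by (elim exE conjE) (rule that)
  have "\<forall>x\<in>P. \<exists>X\<in>F. f x = \<sigma> ` X" using f(2) by (auto simp: image_subset_iff image_iff)
  then obtain h where h: "\<forall>x\<in>P. h x \<in> F \<and> f x = \<sigma> ` h x" by metis
  have "inj_on h P"
  proof (rule inj_onI)
    fix x y assume "x \<in> P" "y \<in> P" "h x = h y"
    then show "x = y" using f(1) h by (metis inj_onD)
  qed
  moreover have "\<forall>x\<in>P. \<forall>y\<in>P. h x < h y \<longleftrightarrow> x < y"
    using f(3) h inj by (metis inj_image_subset_iff less_le_not_le)
  moreover have "h ` P \<subseteq> F" using h by blast
  ultimately show False using free unfolding contains_induced_copy_def by blast
qed

lemma card_induced_free_le_La_star:
  assumes "F \<in> induced_free_families n P"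
  shows "card F \<le> La_star n P"
proof -
  have "induced_free_families n P \<subseteq> Pow (Pow {1..n})" by (auto simp: induced_free_families_def)
  then have "finite (induced_free_families n P)" by (rule finite_subset) simp
  then show ?thesis unfolding La_star_def using assms by simp
qed

section \<open>Averaging over permutations of the ground set\<close>

lemma permutes_nested_pair:
  assumes "finite V" "A \<subseteq> B" "B \<subseteq> V" "A' \<subseteq> B'" "B' \<subseteq> V" "card A = card A'" "card B = card B'"
  shows "\<exists>\<tau>. \<tau> permutes V \<and> \<tau> ` A = A' \<and> \<tau> ` B = B'"
proof -
  have fin: "finite A" "finite A'" "finite B" "finite B'"
    using assms finite_subset by metis+
  obtain f where f: "bij_betw f A A'"
    using finite_same_card_bij[of A A'] fin assms(6) by auto
  have "card (B - A) = card (B' - A')" using assms fin by (simp add: card_Diff_subset)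
  then obtain g where g: "bij_betw g (B - A) (B' - A')"
    using finite_same_card_bij[of "B - A" "B' - A'"] fin by auto
  have "card (V - B) = card (V - B')" using assms fin by (simp add: card_Diff_subset)
  then obtain h where h: "bij_betw h (V - B) (V - B')"
    using finite_same_card_bij[of "V - B" "V - B'"] assms(1) by auto
  define \<tau> where "\<tau> x = (if x \<in> A then f x else if x \<in> B then g x else if x \<in> V then h x else x)" for x
  have 1: "bij_betw \<tau> A A'" using f by (rule bij_betw_cong[THEN iffD1, rotated]) (simp add: \<tau>_def)
  have 2: "bij_betw \<tau> (B - A) (B' - A')" using g by (rule bij_betw_cong[THEN iffD1, rotated]) (simp add: \<tau>_def)
  have 3: "bij_betw \<tau> (V - B) (V - B')" using h
    by (rule bij_betw_cong[THEN iffD1, rotated]) (use assms in \<open>auto simp: \<tau>_def\<close>)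
  have B: "bij_betw \<tau> B B'"
    using bij_betw_combine[OF 1 2] assms by (simp add: Un_absorb1)
  have "bij_betw \<tau> V V"
    using bij_betw_combine[OF B 3] assms by (simp add: Un_absorb1)
  then have "\<tau> permutes V"
    by (rule bij_imp_permutes) (use assms in \<open>auto simp: \<tau>_def\<close>)
  then show ?thesis using 1 B by (auto simp: bij_betw_def)
qed

text \<open>
  Permuting the family at random is the device that turns a statement about one interval into a statement
  about all intervals with the same pair of end point sizes.
\<close>

definition hit_perms :: "nat \<Rightarrow> nat set set \<Rightarrow> nat set \<Rightarrow> nat set \<Rightarrow> (nat \<Rightarrow> nat) set" where
  "hit_perms n F A B = {\<sigma>. \<sigma> permutes {1..n} \<and> (\<exists>X\<in>F. A \<subseteq> \<sigma> ` X \<and> \<sigma> ` X \<subseteq> B)}"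

lemma finite_hit_perms: "finite (hit_perms n F A B)"
  by (rule finite_subset[OF _ finite_permutations[of "{1..n}"]]) (auto simp: hit_perms_def)

lemma card_hit_perms_le:
  assumes "A \<subseteq> B" "B \<subseteq> {1..n}" "A' \<subseteq> B'" "B' \<subseteq> {1..n}" "card A = card A'" "card B = card B'"
  shows "card (hit_perms n F A B) \<le> card (hit_perms n F A' B')"
proof -
  obtain \<tau> where \<tau>: "\<tau> permutes {1..n}" "\<tau> ` A = A'" "\<tau> ` B = B'"
    using permutes_nested_pair[of "{1..n}" A B A' B'] assms by auto
  have "(\<circ>) \<tau> ` hit_perms n F A B \<subseteq> hit_perms n F A' B'"
  proof
    fix \<rho> assume "\<rho> \<in> (\<circ>) \<tau> ` hit_perms n F A B"
    then obtain \<sigma> X where \<sigma>: "\<rho> = \<tau> \<circ> \<sigma>" "\<sigma> permutes {1..n}" "X \<in> F" "A \<subseteq> \<sigma> ` X" "\<sigma> ` X \<subseteq> B"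
      by (auto simp: hit_perms_def)
    have "A' \<subseteq> \<rho> ` X" "\<rho> ` X \<subseteq> B'"
      using \<sigma> \<tau> by (auto simp: image_comp[symmetric])
    moreover have "\<rho> permutes {1..n}" using \<sigma> \<tau> by (simp add: permutes_compose)
    ultimately show "\<rho> \<in> hit_perms n F A' B'" using \<sigma> by (auto simp: hit_perms_def)
  qed
  moreover have "inj ((\<circ>) \<tau>)"
    using permutes_inj[OF \<tau>(1)] by (simp add: fun.inj_map)
  ultimately show ?thesis
    using card_inj_on_le[of "(\<circ>) \<tau>" "hit_perms n F A B"] finite_hit_perms
    by (meson inj_on_subset subset_UNIV)
qed

text \<open>
  By symmetry (\<open>card_hit_perms\<close>) the count for the initial segments serves for every interval of
  length \<open>j\<close> that starts at level \<open>t\<close>.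
\<close>

definition hit_count :: "nat \<Rightarrow> nat set set \<Rightarrow> nat \<Rightarrow> nat \<Rightarrow> nat" where
  "hit_count n F j t = card (hit_perms n F {1..t} {1..t+j})"

lemma card_hit_perms:
  assumes "A \<subseteq> B" "B \<subseteq> {1..n}" "card B = card A + j"
  shows "card (hit_perms n F A B) = hit_count n F j (card A)"
proof -
  have "card B \<le> n" using card_mono[OF _ assms(2)] by simp
  then have "{1..card A} \<subseteq> {1..card A + j}" "{1..card A + j} \<subseteq> {1..n}" using assms by auto
  then show ?thesis unfolding hit_count_def
    using card_hit_perms_le[of A B n "{1..card A}" "{1..card A + j}" F]
      card_hit_perms_le[of "{1..card A}" "{1..card A + j}" n A B F] assms
    by simp
qed

lemma sum_Pow_card:
  fixes h :: "nat \<Rightarrow> nat"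
  assumes "finite V"
  shows "(\<Sum>S\<in>Pow V. h (card S)) = (\<Sum>k\<le>card V. (card V choose k) * h k)"
proof -
  have "(\<Sum>S\<in>Pow V. h (card S)) = (\<Sum>k\<le>card V. \<Sum>S\<in>{S \<in> Pow V. card S = k}. h (card S))"
    by (rule sum.group[symmetric]) (use assms in \<open>auto intro: card_mono\<close>)
  also have "\<dots> = (\<Sum>k\<le>card V. (card V choose k) * h k)"
    using assms by (intro sum.cong refl) (simp add: n_subsets)
  finally show ?thesis .
qed

lemma sum_card_hits:
  assumes "finite \<S>"
  shows "(\<Sum>\<sigma> | \<sigma> permutes {1..n}. card {S \<in> \<S>. \<exists>X\<in>F. L S \<subseteq> \<sigma> ` X \<and> \<sigma> ` X \<subseteq> U S})
       = (\<Sum>S\<in>\<S>. card (hit_perms n F (L S) (U S)))"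
proof -
  have "(\<Sum>\<sigma> | \<sigma> permutes {1..n}. card {S \<in> \<S>. \<exists>X\<in>F. L S \<subseteq> \<sigma> ` X \<and> \<sigma> ` X \<subseteq> U S})
      = (\<Sum>S\<in>\<S>. card {\<sigma> \<in> {\<sigma>. \<sigma> permutes {1..n}}. \<exists>X\<in>F. L S \<subseteq> \<sigma> ` X \<and> \<sigma> ` X \<subseteq> U S})"
    by (rule sum_multicount_gen) (use assms finite_permutations in auto)
  then show ?thesis by (simp add: hit_perms_def)
qed

text \<open>
  The trace of a permuted family consists of the lower ends of those intervals, with upper end
  obtained by adding all of \<open>{n-j<..n}\<close>, which the permuted family meets.
\<close>

lemma sum_card_trace:
  assumes "F \<subseteq> Pow {1..n}" "j \<le> n"
  shows "(\<Sum>\<sigma> | \<sigma> permutes {1..n}. card (trace_on {1..n-j} ((`) \<sigma> ` F)))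
       = (\<Sum>t\<le>n-j. ((n-j) choose t) * hit_count n F j t)"
proof -
  let ?J = "{n-j<..n}"
  have tr: "trace_on {1..n-j} ((`) \<sigma> ` F) = {S \<in> Pow {1..n-j}. \<exists>X\<in>F. S \<subseteq> \<sigma> ` X \<and> \<sigma> ` X \<subseteq> S \<union> ?J}"
    if \<sigma>: "\<sigma> permutes {1..n}" for \<sigma>
  proof -
    have sub: "\<sigma> ` X \<subseteq> {1..n}" if "X \<in> F" for X
      using that assms permutes_image[OF \<sigma>] by blast
    have V: "{1..n} = {1..n-j} \<union> ?J" "{1..n-j} \<inter> ?J = {}" by auto
    have eq: "\<sigma> ` X \<inter> {1..n-j} = S \<longleftrightarrow> S \<in> Pow {1..n-j} \<and> S \<subseteq> \<sigma> ` X \<and> \<sigma> ` X \<subseteq> S \<union> ?J" if "X \<in> F" for S X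
      using sub[OF that] V by blast
    show ?thesis
    proof (rule set_eqI)
      fix S
      have "S \<in> trace_on {1..n-j} ((`) \<sigma> ` F) \<longleftrightarrow> (\<exists>X\<in>F. \<sigma> ` X \<inter> {1..n-j} = S)"
        unfolding trace_on_def by blast
      then show "S \<in> trace_on {1..n-j} ((`) \<sigma> ` F)
          \<longleftrightarrow> S \<in> {S \<in> Pow {1..n-j}. \<exists>X\<in>F. S \<subseteq> \<sigma> ` X \<and> \<sigma> ` X \<subseteq> S \<union> ?J}"
        using eq by simp
    qed
  qed
  have "(\<Sum>\<sigma> | \<sigma> permutes {1..n}. card (trace_on {1..n-j} ((`) \<sigma> ` F)))
      = (\<Sum>S\<in>Pow {1..n-j}. card (hit_perms n F S (S \<union> ?J)))"
    using tr by (simp add: sum_card_hits[where L="\<lambda>S. S", symmetric])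
  also have "\<dots> = (\<Sum>S\<in>Pow {1..n-j}. hit_count n F j (card S))"
  proof (rule sum.cong)
    fix S assume S: "S \<in> Pow {1..n-j}"
    then have "card (S \<union> ?J) = card S + j"
      using assms finite_subset[of S "{1..n-j}"] by (subst card_Un_disjoint) auto
    then show "card (hit_perms n F S (S \<union> ?J)) = hit_count n F j (card S)"
      using S by (intro card_hit_perms) force+
  qed simp
  also have "\<dots> = (\<Sum>t\<le>n-j. ((n-j) choose t) * hit_count n F j t)"
    using sum_Pow_card[of "{1..n-j}" "hit_count n F j"] by simp
  finally show ?thesis .
qed

text \<open>
  The embedding of a small cube into intervals of a large one.  Beyond \<open>{1..m}\<close> there are first \<open>b\<close>
  points contained in all intervals, and then \<open>m + 1\<close> blocks of \<open>j\<close> points.  The lower end \<open>L S\<close>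
  contains the first \<open>card S\<close> blocks, and the interval is spanned by the next block.  A proper superset of
  \<open>S\<close> has more elements, so its lower end already contains that block; and the part inside
  \<open>{1..m}\<close> keeps unrelated indices unrelated.
\<close>

lemma sum_hit_count_le:
  fixes P :: "'a::order set"
  assumes free: "\<not> contains_induced_copy F P" and room: "b + m * (j+1) + j \<le> n"
  shows "(\<Sum>k\<le>m. (m choose k) * hit_count n F j (b + k * (j+1))) \<le> fact n * La_star m P"
proof -
  define L where "L S = S \<union> {m<..m + b + j * card S}" for S
  define U where "U S = S \<union> {m<..m + b + j * card S + j}" for S
  have fin: "finite S" "card S \<le> m" if "S \<in> Pow {1..m}" for S
    using that card_mono[of "{1..m}" S] finite_subset[of S "{1..m}"] by auto
  have above: "U S \<subseteq> L T" if "S \<in> Pow {1..m}" "T \<in> Pow {1..m}" "S \<subset> T" for S T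
  proof -
    have "card S < card T" using that fin psubset_card_mono by blast
    then have "j * (card S + 1) \<le> j * card T" by (intro mult_le_mono) auto
    then show ?thesis using that by (auto simp: L_def U_def)
  qed
  have apart: "S \<subseteq> T" if "S \<in> Pow {1..m}" "T \<in> Pow {1..m}" "L S \<subseteq> U T" for S T
  proof
    fix i assume "i \<in> S"
    then have "i \<in> U T" "i \<le> m" using that by (auto simp: L_def)
    then show "i \<in> T" by (auto simp: U_def)
  qed
  have cL: "card (L S) = b + card S * (j+1)" and cU: "card (U S) = card (L S) + j"
    and sub: "L S \<subseteq> U S" "U S \<subseteq> {1..n}" if S: "S \<in> Pow {1..m}" for S
  proof -
    show L: "card (L S) = b + card S * (j+1)"
      unfolding L_def using S fin[OF S] by (subst card_Un_disjoint) (auto simp: algebra_simps)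
    show "card (U S) = card (L S) + j"
      unfolding L unfolding U_def using S fin[OF S]
      by (subst card_Un_disjoint) (auto simp: algebra_simps)
    show "L S \<subseteq> U S" by (auto simp: L_def U_def)
    have "j * card S \<le> j * m" using fin[OF S] by (intro mult_le_mono2)
    then have le: "m + b + j * card S + j \<le> n" using room unfolding distrib_left mult.commute[of m] by linarith
    show "U S \<subseteq> {1..n}"
    proof
      fix i assume "i \<in> U S"
      then have "i \<in> {1..m} \<or> i \<in> {m<..m + b + j * card S + j}"
        using S unfolding U_def by blast
      then show "i \<in> {1..n}" using le by auto
    qed
  qed
  have "(\<Sum>k\<le>m. (m choose k) * hit_count n F j (b + k * (j+1)))
      = (\<Sum>S\<in>Pow {1..m}. hit_count n F j (b + card S * (j+1)))"
    using sum_Pow_card[of "{1..m}" "\<lambda>k. hit_count n F j (b + k * (j+1))"] by simp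
  also have "\<dots> = (\<Sum>S\<in>Pow {1..m}. card (hit_perms n F (L S) (U S)))"
    using cL cU sub by (intro sum.cong refl) (metis card_hit_perms)
  also have "\<dots> = (\<Sum>\<sigma> | \<sigma> permutes {1..n}. card {S \<in> Pow {1..m}. \<exists>X\<in>F. L S \<subseteq> \<sigma> ` X \<and> \<sigma> ` X \<subseteq> U S})"
    by (rule sum_card_hits[symmetric]) simp
  also have "\<dots> \<le> (\<Sum>\<sigma> | \<sigma> permutes {1..n}. La_star m P)"
  proof (rule sum_mono)
    fix \<sigma> assume "\<sigma> \<in> {\<sigma>. \<sigma> permutes {1..n}}"
    then have "\<not> contains_induced_copy ((`) \<sigma> ` F) P"
      using induced_free_image[OF free] permutes_inj by blast
    from induced_free_interval_hits[OF this, of "Pow {1..m}" U L] above apart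
    have "\<not> contains_induced_copy {S \<in> Pow {1..m}. \<exists>X\<in>(`) \<sigma> ` F. L S \<subseteq> X \<and> X \<subseteq> U S} P"
      by blast
    then show "card {S \<in> Pow {1..m}. \<exists>X\<in>F. L S \<subseteq> \<sigma> ` X \<and> \<sigma> ` X \<subseteq> U S} \<le> La_star m P"
      by (intro card_induced_free_le_La_star) (auto simp: induced_free_families_def)
  qed
  also have "\<dots> = fact n * La_star m P"
    by (simp add: card_permutations)
  finally show ?thesis .
qed

section \<open>Comparing the levels of two cubes\<close>

lemma binomial_Suc_ratio: "(n choose Suc k) * Suc k = (n choose k) * (n - k)"
  using binomial_absorption[of k n] binomial_absorb_comp[of n k] by (simp add: mult.commute)

lemma ratio_polynomial_bound:
  fixes K d :: nat
  assumes "1 \<le> K" "K + 4 \<le> d"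
  shows "(K + 1)\<^sup>2 * (d + 1) \<le> K * d\<^sup>2"
proof -
  obtain e f where "d = K + 4 + e" "K = 1 + f"
    using assms by (metis le_Suc_ex)
  then show ?thesis by (simp add: algebra_simps power2_eq_square)
qed

text \<open>
  Below the middle, \<open>q\<close> levels of the large cube shrink at least as much as one level of the small cube.
  With \<open>K = k + 1\<close>, each of the \<open>q\<close> consecutive quotients in the large cube is at most
  \<open>\<rho> = (K+1) / (m-K)\<close>, which exceeds the quotient \<open>K / (m-K+1)\<close> of the small cube only slightly, so
  already \<open>\<rho>\<^sup>2\<close> falls below it; this is where \<open>q \<ge> 2\<close> enters.
\<close>

lemma binomial_decay_step:
  assumes q: "2 \<le> q" and m: "(m+1) * q \<le> n + 1" and k: "2 * k + 6 \<le> m" and t: "t < (k+1) * q"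
  shows "real (n choose t) * real (m choose (k+1)) \<le> real (n choose (t+q)) * real (m choose k)"
proof -
  define K where "K = k + 1"
  define \<rho> where "\<rho> = real (K+1) / real (m-K)"
  have Km: "K + 4 \<le> m - K" "1 \<le> K" using k by (auto simp: K_def)
  have \<rho>: "0 \<le> \<rho>" "\<rho> \<le> 1" using Km by (auto simp: \<rho>_def)
  have one: "real (n choose s) \<le> \<rho> * real (n choose (s+1))" if s: "s + 1 \<le> t + q" for s
  proof -
    \<comment> \<open>As \<open>s + 2 \<le> (K+1) * q\<close> and \<open>n + 1 \<ge> (m+1) * q\<close>, at least \<open>(m-K) * q\<close> elements lie outside an \<open>s\<close>-set.\<close>
    have K1: "(K+1) * q = (k+1) * q + q" by (simp add: K_def)
    have "(m+1) * q = (m-K) * q + (K+1) * q"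
      using Km by (simp add: add_mult_distrib[symmetric])
    then have "(m-K) * q \<le> n - s" using m s t K1 by linarith
    then have "(n choose s) * ((m-K) * q) \<le> (n choose s) * (n - s)" by simp
    also have "\<dots> = (n choose (s+1)) * (s+1)" using binomial_Suc_ratio[of n s] by simp
    also have "\<dots> \<le> (n choose (s+1)) * ((K+1) * q)"
      using s t K1 by (intro mult_le_mono2) linarith
    finally have "((n choose s) * (m-K)) * q \<le> ((n choose (s+1)) * (K+1)) * q"
      by (simp only: mult.assoc)
    then have "(n choose s) * (m-K) \<le> (n choose (s+1)) * (K+1)"
      by (rule mult_right_le_imp_le) (use q in simp)
    then have "real (n choose s) * real (m-K) \<le> real (n choose (s+1)) * real (K+1)"
      by (metis of_nat_le_iff of_nat_mult)
    then show ?thesis using Km by (simp add: \<rho>_def field_simps)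
  qed
  have "real (n choose t) \<le> \<rho> ^ i * real (n choose (t+i))" if "i \<le> q" for i
    using that
  proof (induction i)
    case (Suc i)
    have "real (n choose t) \<le> \<rho> ^ i * real (n choose (t+i))" using Suc by simp
    also have "\<dots> \<le> \<rho> ^ i * (\<rho> * real (n choose (t+i+1)))"
      using one[of "t+i"] Suc \<rho> by (intro mult_left_mono) auto
    finally show ?case by (simp add: ac_simps)
  qed simp
  then have "real (n choose t) \<le> \<rho> ^ q * real (n choose (t+q))" by simp
  also have "\<dots> \<le> \<rho>\<^sup>2 * real (n choose (t+q))"
    using \<rho> q by (intro mult_right_mono power_decreasing) auto
  finally have 1: "real (n choose t) \<le> \<rho>\<^sup>2 * real (n choose (t+q))" .
  have "real (m choose K) * real K = real (m choose k) * real (m - k)"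
    using binomial_Suc_ratio[of m k] unfolding K_def by (metis Suc_eq_plus1 of_nat_mult)
  moreover have "\<rho>\<^sup>2 * real (m - k) \<le> real K"
  proof -
    have "real ((K+1)\<^sup>2 * (m-K+1)) \<le> real (K * (m-K)\<^sup>2)"
      using ratio_polynomial_bound[of K "m-K"] Km by (intro of_nat_mono) auto
    moreover have "m - k = m - K + 1" using Km by (simp add: K_def)
    ultimately show ?thesis using Km by (simp add: \<rho>_def field_simps)
  qed
  ultimately have "\<rho>\<^sup>2 * (real (m choose K) * real K) \<le> real (m choose k) * real K"
    using mult_left_mono[of "\<rho>\<^sup>2 * real (m - k)" "real K" "real (m choose k)"]
    by (simp add: ac_simps)
  then have 2: "\<rho>\<^sup>2 * real (m choose K) \<le> real (m choose k)" using Km by simp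
  have "real (n choose t) * real (m choose K) \<le> (\<rho>\<^sup>2 * real (n choose (t+q))) * real (m choose K)"
    using 1 by (rule mult_right_mono) simp
  also have "\<dots> = real (n choose (t+q)) * (\<rho>\<^sup>2 * real (m choose K))" by simp
  also have "\<dots> \<le> real (n choose (t+q)) * real (m choose k)"
    using 2 by (rule mult_left_mono) simp
  finally show ?thesis by (simp add: K_def)
qed

text \<open>
  For such \<open>m\<close> neighbouring binomial coefficients near the middle differ by a factor of at most \<open>2\<close>,
  and \<open>k\<close> is at most two steps away from \<open>m div 2\<close>.
\<close>

lemma central_binomials_comparable:
  assumes m: "20 \<le> m" and k: "m < 2 * k + 6" "2 * k \<le> m + 2"
  shows "(m choose (m div 2)) \<le> 8 * (m choose k)"
proof -
  define h where "h = m div 2"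
  have half: "(m choose Suc i) \<le> 2 * (m choose i)" if "h - 2 \<le> i" for i
  proof -
    have "(m choose Suc i) * Suc i = (m choose i) * (m - i)" by (rule binomial_Suc_ratio)
    also have "\<dots> \<le> (m choose i) * (2 * Suc i)"
      using that m by (intro mult_le_mono2) (simp add: h_def)
    finally have "(m choose Suc i) * Suc i \<le> (2 * (m choose i)) * Suc i" by (simp add: ac_simps)
    then show ?thesis by (simp only: mult_le_cancel2)
  qed
  have low: "(m choose h) \<le> 4 * (m choose (h-2))" "(m choose h) \<le> 2 * (m choose (h-1))"
  proof -
    have "Suc (h-2) = h-1" "Suc (h-1) = h" using m by (auto simp: h_def)
    then show "(m choose h) \<le> 4 * (m choose (h-2))" "(m choose h) \<le> 2 * (m choose (h-1))"
      using half[of "h-2"] half[of "h-1"] by auto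
  qed
  have "k = h - 2 \<or> k = h - 1 \<or> k = h \<or> k = h + 1" using k by (auto simp: h_def)
  moreover have "(m choose h) \<le> 8 * (m choose (h+1))"
  proof -
    have "(m choose (h+1)) = (m choose (m - (h+1)))"
      using m by (intro binomial_symmetric) (simp add: h_def)
    moreover have "m - (h+1) = h \<or> m - (h+1) = h - 1" by (auto simp: h_def)
    ultimately show ?thesis using low by auto
  qed
  ultimately show ?thesis using low by (auto simp: h_def)
qed

text \<open>
  Near the middle the claim holds since the left factor is at most the central coefficient; from there it
  propagates downwards by \<open>binomial_decay_step\<close>.
\<close>

lemma binomial_compare:
  assumes q: "2 \<le> q" and m: "(m+1) * q \<le> n + 1" "20 \<le> m" and k: "2 * (t div q) \<le> m + 2"
  shows "real (n choose t) * real (m choose (m div 2))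
    \<le> 8 * real (m choose (t div q)) * real (n choose (n div 2))"
  using k
proof (induction "m - t div q" arbitrary: t rule: less_induct)
  case less
  let ?k = "t div q"
  have tk: "t < (?k+1) * q" using q dividend_less_div_times[of q t] by simp
  show ?case
  proof (cases "m < 2 * ?k + 6")
    case True
    have "real (m choose (m div 2)) \<le> 8 * real (m choose ?k)"
      using of_nat_mono[OF central_binomials_comparable[OF m(2) True less.prems], where 'a=real]
      by simp
    moreover have "real (n choose t) \<le> real (n choose (n div 2))"
      by (simp add: binomial_maximum)
    ultimately have "real (n choose t) * real (m choose (m div 2))
        \<le> real (n choose (n div 2)) * (8 * real (m choose ?k))"
      by (intro mult_mono) auto
    then show ?thesis by (simp add: ac_simps)
  next
    case False
    have k1: "(t + q) div q = ?k + 1" using q by simp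
    have IH: "real (n choose (t+q)) * real (m choose (m div 2))
        \<le> 8 * real (m choose (?k+1)) * real (n choose (n div 2))"
      using less.hyps[of "t+q"] False unfolding k1 by simp
    have step: "real (n choose t) * real (m choose (?k+1)) \<le> real (n choose (t+q)) * real (m choose ?k)"
      using binomial_decay_step[OF q m(1) _ tk] False by simp
    have "real (m choose (?k+1)) * (real (n choose t) * real (m choose (m div 2)))
        \<le> real (m choose ?k) * (real (n choose (t+q)) * real (m choose (m div 2)))"
      using mult_right_mono[OF step, of "real (m choose (m div 2))"] by (simp add: ac_simps)
    also have "\<dots> \<le> real (m choose ?k) * (8 * real (m choose (?k+1)) * real (n choose (n div 2)))"
      using IH by (rule mult_left_mono) simp
    finally have "real (m choose (?k+1)) * (real (n choose t) * real (m choose (m div 2)))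
        \<le> real (m choose (?k+1)) * (8 * real (m choose ?k) * real (n choose (n div 2)))"
      by (simp add: ac_simps)
    moreover have "0 < real (m choose (?k+1))" using False by simp
    ultimately show ?thesis by (simp only: mult_le_cancel_left_pos)
  qed
qed

text \<open>
  The levels \<open>t\<close> are sorted by their residue modulo \<open>q\<close>: the levels \<open>u + k * q\<close> with a fixed \<open>u\<close>
  are those visited by one embedded small cube.
\<close>

lemma lower_half_sum_le:
  fixes H :: "nat \<Rightarrow> real"
  assumes q: "2 \<le> q" and m: "(m+1) * q \<le> n + 1" "n + 1 < (m+2) * q" "20 \<le> m"
    and nonneg: "\<And>t. 0 \<le> H t"
    and H: "\<And>u. u < q \<Longrightarrow> (\<Sum>k\<le>m. real (m choose k) * H (u + k * q)) \<le> D * real (m choose (m div 2))"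
  shows "(\<Sum>t | 2 * t \<le> n. real (n choose t) * H t) \<le> 8 * real q * D * real (n choose (n div 2))"
proof -
  define c where "c = 8 * real (n choose (n div 2)) / real (m choose (m div 2))"
  define g where "g = (\<lambda>(u, k). c * (real (m choose k) * H (u + k * q)))"
  let ?T = "{t. 2 * t \<le> n}" and ?s = "\<lambda>t. (t mod q, t div q)"
  have Nm: "0 < real (m choose (m div 2))" by simp
  have c: "0 \<le> c" by (simp add: c_def)
  have k: "2 * (t div q) < m + 2" if "t \<in> ?T" for t
  proof -
    have "(t div q) * q \<le> t" by (rule div_times_less_eq_dividend)
    moreover have "(2 * (t div q)) * q = 2 * ((t div q) * q)" by simp
    moreover have "2 * t \<le> n" using that by simp
    ultimately have "(2 * (t div q)) * q < (m + 2) * q" using m(2) by linarith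
    then show ?thesis by (simp only: mult_less_cancel2)
  qed
  have "(\<Sum>t\<in>?T. real (n choose t) * H t) \<le> (\<Sum>t\<in>?T. g (?s t))"
  proof (rule sum_mono)
    fix t assume t: "t \<in> ?T"
    have "real (n choose t) * real (m choose (m div 2))
        \<le> 8 * real (m choose (t div q)) * real (n choose (n div 2))"
      using binomial_compare[OF q m(1,3), of t] k[OF t] by simp
    then have "real (n choose t) \<le> c * real (m choose (t div q))"
      using Nm by (simp add: c_def field_simps)
    from mult_right_mono[OF this nonneg[of t]]
    show "real (n choose t) * H t \<le> g (?s t)" by (simp add: g_def ac_simps)
  qed
  also have "\<dots> = (\<Sum>p\<in>?s ` ?T. g p)"
  proof (rule sum.reindex_cong[symmetric])
    show "inj_on ?s ?T" by (rule inj_onI) (metis mod_div_mult_eq prod.inject)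
  qed auto
  also have "\<dots> \<le> (\<Sum>p\<in>{..<q} \<times> {..m}. g p)"
  proof (rule sum_mono2)
    show "?s ` ?T \<subseteq> {..<q} \<times> {..m}" using k q m(3) by fastforce
  qed (use c nonneg in \<open>auto simp: g_def\<close>)
  also have "\<dots> = (\<Sum>u<q. c * (\<Sum>k\<le>m. real (m choose k) * H (u + k * q)))"
    by (simp add: g_def sum.cartesian_product sum_distrib_left)
  also have "\<dots> \<le> (\<Sum>u<q. c * (D * real (m choose (m div 2))))"
    using H c by (intro sum_mono mult_left_mono) auto
  also have "\<dots> = 8 * real q * D * real (n choose (n div 2))"
  proof -
    have "c * real (m choose (m div 2)) = 8 * real (n choose (n div 2))"
      unfolding c_def using Nm by (intro nonzero_divide_eq_eq[THEN iffD1]) auto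
    then show ?thesis by (simp add: algebra_simps)
  qed
  finally show ?thesis .
qed

section \<open>The average size of a trace\<close>

text \<open>
  The lower half of the levels is covered by embedded cubes anchored at the bottom.  As \<open>m\<close> is obtained
  by rounding, these may miss some of the top levels, so the upper half is covered by cubes anchored at
  the top; reflection reduces it to the same estimate.
\<close>

lemma sum_card_trace_le:
  fixes P :: "'a::order set"
  assumes F: "F \<subseteq> Pow {1..n}" and free: "\<not> contains_induced_copy F P"
    and j: "1 \<le> j" "j \<le> n" and m: "m + 1 = (n - j + 1) div (j + 1)" "20 \<le> m"
    and La: "real (La_star m P) \<le> C * real (m choose (m div 2))"
  shows "(\<Sum>\<sigma> | \<sigma> permutes {1..n}. real (card (trace_on {1..n-j} ((`) \<sigma> ` F))))
    \<le> fact n * (16 * real (j+1) * C * real ((n-j) choose ((n-j) div 2)))"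
proof -
  define q where "q = j + 1"
  define l where "l = n - j"
  define H where "H t = real (hit_count n F j t)" for t
  define D where "D = fact n * C"
  have q: "2 \<le> q" using j by (simp add: q_def)
  have mq: "(m+1) * q \<le> l + 1" "l + 1 < (m+2) * q"
  proof -
    have "m + 1 = (l + 1) div q" using m by (simp add: l_def q_def)
    moreover have "(l+1) div q * q \<le> l + 1" by (rule div_times_less_eq_dividend)
    moreover have "l + 1 < q + (l+1) div q * q" using q by (intro dividend_less_div_times) simp
    ultimately show "(m+1) * q \<le> l + 1" "l + 1 < (m+2) * q" by (simp_all add: algebra_simps)
  qed
  have main: "(\<Sum>k\<le>m. real (m choose k) * H (b + k * q)) \<le> D * real (m choose (m div 2))"
    if b: "b + m * q \<le> l" for b
  proof -
    have "(\<Sum>k\<le>m. real (m choose k) * H (b + k * q))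
        = real (\<Sum>k\<le>m. (m choose k) * hit_count n F j (b + k * (j+1)))"
      by (simp add: H_def q_def)
    also have "\<dots> \<le> real (fact n * La_star m P)"
      using b j by (intro of_nat_mono sum_hit_count_le[OF free]) (simp add: l_def q_def)
    also have "\<dots> = fact n * real (La_star m P)" by simp
    also have "\<dots> \<le> fact n * (C * real (m choose (m div 2)))"
      using La by (rule mult_left_mono) simp
    finally show ?thesis by (simp add: D_def ac_simps)
  qed
  have lower: "(\<Sum>t | 2 * t \<le> l. real (l choose t) * H t) \<le> 8 * real q * D * real (l choose (l div 2))"
  proof (rule lower_half_sum_le[OF q mq m(2)])
    fix u assume "u < q"
    then show "(\<Sum>k\<le>m. real (m choose k) * H (u + k * q)) \<le> D * real (m choose (m div 2))"
      using mq(1) by (intro main) simp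
  qed (simp add: H_def)
  have upper: "(\<Sum>t | 2 * t \<le> l. real (l choose t) * H (l - t)) \<le> 8 * real q * D * real (l choose (l div 2))"
  proof (rule lower_half_sum_le[OF q mq m(2)])
    fix u assume "u < q"
    then have u: "u + m * q \<le> l" using mq(1) by simp
    have "(\<Sum>k\<le>m. real (m choose k) * H (l - (u + k * q)))
        = (\<Sum>k\<le>m. real (m choose (m - k)) * H (l - (u + (m - k) * q)))"
      by (rule sum.nat_diff_reindex[symmetric, of "\<lambda>k. real (m choose k) * H (l - (u + k * q))" "Suc m", simplified lessThan_Suc_atMost, simplified])
    also have "\<dots> = (\<Sum>k\<le>m. real (m choose k) * H ((l - (u + m * q)) + k * q))"
    proof (rule sum.cong)
      fix k assume "k \<in> {..m}"
      then have k: "k \<le> m" by simp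
      then have "m * q = (m - k) * q + k * q" by (simp add: add_mult_distrib[symmetric])
      then have "l - (u + (m - k) * q) = (l - (u + m * q)) + k * q" using u by linarith
      then show "real (m choose (m - k)) * H (l - (u + (m - k) * q))
          = real (m choose k) * H ((l - (u + m * q)) + k * q)"
        using binomial_symmetric[OF k] by simp
    qed simp
    also have "\<dots> \<le> D * real (m choose (m div 2))"
      using u by (intro main) simp
    finally show "(\<Sum>k\<le>m. real (m choose k) * H (l - (u + k * q))) \<le> D * real (m choose (m div 2))" .
  qed (simp add: H_def)
  have fin: "finite {t. 2 * t \<le> l}" by (rule finite_subset[of _ "{..l}"]) auto
  have "(\<Sum>\<sigma> | \<sigma> permutes {1..n}. real (card (trace_on {1..n-j} ((`) \<sigma> ` F))))
      = real (\<Sum>t\<le>l. (l choose t) * hit_count n F j t)"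
    unfolding l_def sum_card_trace[OF F j(2), symmetric] by simp
  also have "\<dots> = (\<Sum>t\<le>l. real (l choose t) * H t)" by (simp add: H_def)
  also have "\<dots> = (\<Sum>t | 2 * t \<le> l. real (l choose t) * H t) + (\<Sum>t | t \<le> l \<and> l < 2 * t. real (l choose t) * H t)"
  proof -
    have "{..l} = {t. 2 * t \<le> l} \<union> {t. t \<le> l \<and> l < 2 * t}" by auto
    then show ?thesis using fin by (subst sum.union_disjoint[symmetric]) auto
  qed
  also have "(\<Sum>t | t \<le> l \<and> l < 2 * t. real (l choose t) * H t)
      = (\<Sum>s | 2 * s < l. real (l choose s) * H (l - s))"
  proof (rule sum.reindex_bij_witness[of _ "\<lambda>s. l - s" "\<lambda>t. l - t"])
    fix t assume "t \<in> {t. t \<le> l \<and> l < 2 * t}"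
    then show "real (l choose (l - t)) * H (l - (l - t)) = real (l choose t) * H t"
      using binomial_symmetric[of t l] by simp
  qed auto
  also have "\<dots> \<le> (\<Sum>s | 2 * s \<le> l. real (l choose s) * H (l - s))"
    using fin by (intro sum_mono2) (auto simp: H_def)
  finally have "(\<Sum>\<sigma> | \<sigma> permutes {1..n}. real (card (trace_on {1..n-j} ((`) \<sigma> ` F))))
      \<le> 16 * real q * D * real (l choose (l div 2))"
    using lower upper by simp
  then show ?thesis by (simp add: D_def q_def l_def ac_simps)
qed

section \<open>Central binomial coefficients\<close>

lemma power2_le_central_binomial: "2 ^ n \<le> (n + 1) * (n choose (n div 2))"
proof -
  have "2 ^ n = (\<Sum>k\<le>n. n choose k)" by (simp add: choose_row_sum)
  also have "\<dots> \<le> (\<Sum>k\<le>n. n choose (n div 2))" by (intro sum_mono binomial_maximum)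
  finally show ?thesis by simp
qed

text \<open>
  The true ratio tends to \<open>1/2\<close>; any constant ratio below \<open>1\<close> makes the sum over the traces
  converge.
\<close>

lemma central_binomial_pred_le:
  assumes "2 \<le> n"
  shows "3 * ((n - 1) choose ((n - 1) div 2)) \<le> 2 * (n choose (n div 2))"
proof -
  define k where "k = n div 2"
  have "(n - 1) choose ((n - 1) div 2) = (n - 1) choose k"
  proof (cases "even n")
    case True
    then have "(n - 1) div 2 = (n - 1) - k" "k \<le> n - 1" using assms by (auto simp: k_def elim!: evenE)
    then show ?thesis using binomial_symmetric[of k "n - 1"] by simp
  qed (auto simp: k_def elim!: oddE)
  then have "n * (3 * ((n - 1) choose ((n - 1) div 2))) = 3 * ((n - k) * (n choose k))"
    using binomial_absorb_comp[of n k] by simp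
  also have "\<dots> = (3 * (n - k)) * (n choose k)" by simp
  also have "\<dots> \<le> (2 * n) * (n choose k)"
    using assms by (intro mult_le_mono1) (simp add: k_def)
  finally have "n * (3 * ((n - 1) choose ((n - 1) div 2))) \<le> n * (2 * (n choose k))" by simp
  then show ?thesis using assms by (simp add: k_def)
qed

lemma central_binomial_diff_le:
  assumes "j < n"
  shows "real ((n - j) choose ((n - j) div 2)) \<le> (2/3) ^ j * real (n choose (n div 2))"
  using assms
proof (induction j)
  case (Suc j)
  have "3 * ((n - Suc j) choose ((n - Suc j) div 2)) \<le> 2 * ((n - j) choose ((n - j) div 2))"
    using central_binomial_pred_le[of "n - j"] Suc by simp
  then have "3 * real ((n - Suc j) choose ((n - Suc j) div 2)) \<le> 2 * real ((n - j) choose ((n - j) div 2))"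
    by linarith
  moreover have "real ((n - j) choose ((n - j) div 2)) \<le> (2/3) ^ j * real (n choose (n div 2))"
    using Suc by simp
  ultimately show ?case by simp
qed simp

lemma sum_Suc_two_thirds_powers_le: "(\<Sum>j=1..r. real (j+1) * (2/3) ^ j) \<le> 8"
proof -
  \<comment> \<open>The series over all \<open>j \<ge> 1\<close> has value \<open>8\<close>; the subtracted term is its tail.\<close>
  have "(\<Sum>j=1..r. real (j+1) * (2/3) ^ j) = 8 - (2 * real r + 8) * (2/3) ^ r"
    by (induction r) (simp_all add: field_simps)
  then show ?thesis by simp
qed

section \<open>Counting induced free families\<close>

lemma exists_permutation_small_traces:
  fixes T :: "(nat \<Rightarrow> nat) \<Rightarrow> nat"
  assumes "(\<Sum>\<sigma> | \<sigma> permutes {1..n}. real (T \<sigma>)) \<le> fact n * B"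
  shows "\<exists>\<sigma>. \<sigma> permutes {1..n} \<and> real (T \<sigma>) \<le> B"
proof (rule ccontr)
  assume "\<not> ?thesis"
  then have "(\<Sum>\<sigma> | \<sigma> permutes {1..n}. B) < (\<Sum>\<sigma> | \<sigma> permutes {1..n}. real (T \<sigma>))"
    by (intro sum_strict_mono finite_permutations) (auto intro: permutes_id)
  then show False using assms by (simp add: card_permutations)
qed

text \<open>
  Each free family is sent to a permutation with small traces together with the permuted family, from which
  it can be recovered.  A family whose traces have total size at most \<open>B\<close> has weight at least
  \<open>exp (- (ln 3 * B))\<close> in \<open>sum_families_weighted_by_traces\<close>.
\<close>

lemma forb_star_le:
  fixes P :: "'a::order set"
  assumes r: "r \<le> n"
    and B: "\<And>F. F \<in> induced_free_families n P \<Longrightarrow>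
      (\<Sum>\<sigma> | \<sigma> permutes {1..n}. real (\<Sum>j=1..r. card (trace_on {1..n-j} ((`) \<sigma> ` F)))) \<le> fact n * B"
  shows "real (forb_star n P) \<le> fact n * (exp (ln 3 * B) * 2 ^ (2 ^ (n-r)))"
proof -
  define w where "w G = (\<Sum>j=1..r. card (trace_on {1..n-j} G))" for G :: "nat set set"
  define \<G> where "\<G> = {G \<in> Pow (Pow {1..n}). real (w G) \<le> B}"
  have fin: "finite \<G>" by (simp add: \<G>_def)
  have "\<forall>F\<in>induced_free_families n P. \<exists>\<sigma>. \<sigma> permutes {1..n} \<and> real (w ((`) \<sigma> ` F)) \<le> B"
    unfolding w_def using B by (intro ballI exists_permutation_small_traces)
  then obtain s where s: "\<And>F. F \<in> induced_free_families n P \<Longrightarrow> s F permutes {1..n} \<and> real (w ((`) (s F) ` F)) \<le> B"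
    by metis
  let ?f = "\<lambda>F. (s F, (`) (s F) ` F)"
  have "inj_on ?f (induced_free_families n P)"
  proof (rule inj_onI)
    fix F F' assume F: "F \<in> induced_free_families n P" "?f F = ?f F'"
    have "inj (s F)" using s[OF F(1)] permutes_inj by auto
    then have "inj ((`) (s F))" by (intro injI) (simp add: inj_image_eq_iff)
    moreover have "(`) (s F) ` F = (`) (s F) ` F'" using F(2) by (metis prod.inject)
    ultimately show "F = F'" by (simp only: inj_image_eq_iff)
  qed
  moreover have "?f ` induced_free_families n P \<subseteq> {\<sigma>. \<sigma> permutes {1..n}} \<times> \<G>"
  proof
    fix p assume "p \<in> ?f ` induced_free_families n P"
    then obtain F where F: "F \<in> induced_free_families n P" "p = ?f F" by blast
    have "s F ` X \<subseteq> {1..n}" if "X \<in> F" for X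
      using that F s[OF F(1)] permutes_image[of "s F" "{1..n}"] by (auto simp: induced_free_families_def)
    then show "p \<in> {\<sigma>. \<sigma> permutes {1..n}} \<times> \<G>" using F s[OF F(1)] by (auto simp: \<G>_def)
  qed
  ultimately have "forb_star n P \<le> card ({\<sigma>. \<sigma> permutes {1..n}} \<times> \<G>)"
    unfolding forb_star_def using fin by (intro card_inj_on_le) (auto intro: finite_permutations)
  also have "\<dots> = fact n * card \<G>" by (simp add: card_cartesian_product card_permutations)
  finally have "real (forb_star n P) \<le> real (fact n * card \<G>)" by (rule of_nat_mono)
  then have 1: "real (forb_star n P) \<le> fact n * real (card \<G>)" by simp
  have "real (card \<G>) * exp (- (ln 3 * B)) = (\<Sum>G\<in>\<G>. exp (- (ln 3 * B)))" by simp
  also have "\<dots> \<le> (\<Sum>G\<in>\<G>. (1/3) ^ w G)"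
  proof (rule sum_mono)
    fix G assume "G \<in> \<G>"
    then have "exp (- (ln 3 * B)) \<le> exp (- (ln 3 * real (w G)))" by (simp add: \<G>_def)
    also have "\<dots> = (1/3) ^ w G"
      by (simp add: exp_minus exp_of_nat2_mult power_one_over inverse_eq_divide)
    finally show "exp (- (ln 3 * B)) \<le> (1/3) ^ w G" .
  qed
  also have "\<dots> \<le> (\<Sum>G\<in>Pow (Pow {1..n}). (1/3) ^ w G)"
    by (rule sum_mono2) (auto simp: \<G>_def)
  also have "\<dots> \<le> 2 ^ (2 ^ (n-r))"
    unfolding w_def by (rule sum_families_weighted_by_traces[OF r])
  finally have "real (card \<G>) \<le> exp (ln 3 * B) * 2 ^ (2 ^ (n-r))"
    by (simp add: exp_minus field_simps)
  then have "fact n * real (card \<G>) \<le> fact n * (exp (ln 3 * B) * 2 ^ (2 ^ (n-r)))"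
    by (rule mult_left_mono) simp
  with 1 show ?thesis by (rule order_trans)
qed

lemma La_star_pos:
  fixes P :: "'a::order set"
  assumes "card P \<ge> 2"
  shows "1 \<le> La_star n P"
proof -
  have "\<not> contains_induced_copy {{} :: nat set} P"
  proof
    assume "contains_induced_copy {{} :: nat set} P"
    then obtain f where "inj_on f P" "f ` P \<subseteq> {{} :: nat set}"
      unfolding contains_induced_copy_def by blast
    then have "card P \<le> card {{} :: nat set}" by (intro card_inj_on_le) auto
    then show False using assms by simp
  qed
  then show ?thesis
    using card_induced_free_le_La_star[of "{{}}" n P] by (simp add: induced_free_families_def)
qed

lemma one_le_power2_div_log:
  assumes "2 \<le> p"
  shows "1 \<le> (real p)\<^sup>2 / log 2 (real p)"
proof -
  have "real p \<le> 2 ^ p" using less_exp[of p] by (metis less_imp_le of_nat_le_iff of_nat_numeral of_nat_power)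
  then have "log 2 (real p) \<le> log 2 (2 ^ p)" using assms by (intro log_mono) auto
  also have "\<dots> = real p" by simp
  also have "\<dots> \<le> (real p)\<^sup>2" using assms by (simp add: power2_eq_square)
  finally have "log 2 (real p) \<le> (real p)\<^sup>2" .
  moreover have "0 < log 2 (real p)" using assms by simp
  ultimately show ?thesis by simp
qed

text \<open>
  The assumption on \<open>r\<close> ensures that even for the longest intervals, \<open>j = r\<close>, the embedded cube has
  dimension at least \<open>M\<close>, so that the bound on \<open>La_star\<close> applies to it.
\<close>

lemma forb_star_le_if_large:
  fixes P :: "'a::order set" and M :: nat
  assumes La: "\<And>m. M \<le> m \<Longrightarrow> real (La_star m P) \<le> C * real (m choose (m div 2))"
    and M: "20 \<le> M" and C: "0 \<le> C" and r: "(M+1) * (r+1) + r \<le> n + 1"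
  shows "real (forb_star n P)
    \<le> fact n * (exp (256 * C * real (n choose (n div 2))) * 2 ^ (2 ^ (n-r)))"
proof -
  define N where "N = real (n choose (n div 2))"
  have "r + 1 \<le> (M+1) * (r+1)" by simp
  then have rn: "r < n" using r M by (cases r) auto
  have "real (forb_star n P) \<le> fact n * (exp (ln 3 * (128 * C * N)) * 2 ^ (2 ^ (n-r)))"
  proof (rule forb_star_le)
    fix F assume "F \<in> induced_free_families n P"
    then have F: "F \<subseteq> Pow {1..n}" "\<not> contains_induced_copy F P"
      by (auto simp: induced_free_families_def)
    have one: "(\<Sum>\<sigma> | \<sigma> permutes {1..n}. real (card (trace_on {1..n-j} ((`) \<sigma> ` F))))
        \<le> fact n * (16 * C * N * (real (j+1) * (2/3) ^ j))" if j: "j \<in> {1..r}" for j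
    proof -
      \<comment> \<open>The largest cube for which all shifts \<open>u \<le> j\<close> leave room for the embedding.\<close>
      define m where "m = (n - j + 1) div (j + 1) - 1"
      have "(M+1) * (j+1) \<le> (M+1) * (r+1)" using j by (intro mult_le_mono2) simp
      moreover have "j \<le> r" using j by simp
      ultimately have "(M+1) * (j+1) \<le> n - j + 1" using r rn by linarith
      then have "M + 1 \<le> (n - j + 1) div (j + 1)" by (simp add: less_eq_div_iff_mult_less_eq)
      then have m: "m + 1 = (n - j + 1) div (j + 1)" "M \<le> m" by (auto simp: m_def)
      have "(\<Sum>\<sigma> | \<sigma> permutes {1..n}. real (card (trace_on {1..n-j} ((`) \<sigma> ` F))))
          \<le> fact n * (16 * real (j+1) * C * real ((n-j) choose ((n-j) div 2)))"
        using j rn m M La by (intro sum_card_trace_le[OF F, where m=m]) auto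
      also have "\<dots> \<le> fact n * (16 * real (j+1) * C * ((2/3) ^ j * N))"
        using central_binomial_diff_le[of j n] j rn C
        by (intro mult_left_mono) (auto simp: N_def)
      finally show ?thesis by (simp only: mult_ac)
    qed
    have "(\<Sum>\<sigma> | \<sigma> permutes {1..n}. real (\<Sum>j=1..r. card (trace_on {1..n-j} ((`) \<sigma> ` F))))
        = (\<Sum>j=1..r. \<Sum>\<sigma> | \<sigma> permutes {1..n}. real (card (trace_on {1..n-j} ((`) \<sigma> ` F))))"
      unfolding of_nat_sum by (rule sum.swap)
    also have "\<dots> \<le> (\<Sum>j=1..r. fact n * (16 * C * N * (real (j+1) * (2/3) ^ j)))"
      by (rule sum_mono) (rule one)
    also have "\<dots> = fact n * (16 * C * N * (\<Sum>j=1..r. real (j+1) * (2/3) ^ j))"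
      by (simp only: sum_distrib_left)
    also have "\<dots> \<le> fact n * (16 * C * N * 8)"
      using C sum_Suc_two_thirds_powers_le[of r] by (intro mult_left_mono) (auto simp: N_def)
    finally show "(\<Sum>\<sigma> | \<sigma> permutes {1..n}. real (\<Sum>j=1..r. card (trace_on {1..n-j} ((`) \<sigma> ` F))))
        \<le> fact n * (128 * C * N)" by simp
  qed (use rn in simp)
  also have "\<dots> \<le> fact n * (exp (256 * C * N) * 2 ^ (2 ^ (n-r)))"
  proof -
    have "ln 3 \<le> (2::real)" using ln_le_minus_one[of "3::real"] by simp
    then have "ln 3 * (128 * C * N) \<le> 2 * (128 * C * N)"
      using C by (intro mult_right_mono) (auto simp: N_def)
    then show ?thesis by (intro mult_left_mono mult_right_mono) auto
  qed
  finally show ?thesis by (simp add: N_def)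
qed

theorem theorem1p3:
  fixes P :: "'a::order set" and C :: real and n\<^sub>0 :: nat
  assumes "finite P" and "card P \<ge> 2"
    and "n\<^sub>0 > 0"
    and "\<And>n. n \<ge> n\<^sub>0 \<Longrightarrow> real (La_star n P) \<le> C * real (n choose (n div 2))"
  shows "\<exists>n\<^sub>1::nat. \<forall>n\<ge>n\<^sub>1.
    real (forb_star n P)
      \<le> exp (490 * ((real (card P))\<^sup>2 / log 2 (real (card P))) * C * real (n choose (n div 2)))"
proof -
  have C: "0 < C"
  proof -
    have "1 \<le> C * real (n\<^sub>0 choose (n\<^sub>0 div 2))"
      using La_star_pos[OF assms(2), of n\<^sub>0] assms(4)[of n\<^sub>0] by simp
    then have "0 < C * real (n\<^sub>0 choose (n\<^sub>0 div 2))" by simp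
    then show ?thesis by (simp add: zero_less_mult_iff)
  qed
  define M where "M = max n\<^sub>0 20"
  define a where "a = real (M + 1)"
  define K where "K = (real (card P))\<^sup>2 / log 2 (real (card P))"
  have K: "1 \<le> K" unfolding K_def by (rule one_le_power2_div_log[OF assms(2)])
  have "\<forall>\<^sub>F n::nat in sequentially. a * (2 * log 2 (real n) + 2) + (2 * log 2 (real n) + 1) \<le> real n"
    by real_asymp
  moreover have "\<forall>\<^sub>F n::nat in sequentially. real n * ln (real n) \<le> C * (2 ^ n / (real n + 1))"
    using C by real_asymp
  moreover have "\<forall>\<^sub>F n::nat in sequentially. real n + 1 \<le> C * (real n)\<^sup>2"
    using C by real_asymp
  ultimately have "\<forall>\<^sub>F n::nat in sequentially. real (forb_star n P) \<le> exp (490 * K * C * real (n choose (n div 2)))"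
    using eventually_gt_at_top[of 0]
  proof eventually_elim
    case (elim n)
    define N where "N = real (n choose (n div 2))"
    \<comment> \<open>This choice gives \<open>2 ^ r \<ge> n\<^sup>2\<close>, so that \<open>2 ^ (n-r)\<close> is below \<open>C * N\<close> for large \<open>n\<close>, however small \<open>C > 0\<close> is.\<close>
    define r where "r = nat \<lceil>2 * log 2 (real n)\<rceil>"
    have log0: "0 \<le> log 2 (real n)" using elim by simp
    then have r: "2 * log 2 (real n) \<le> real r" "real r \<le> 2 * log 2 (real n) + 1"
      unfolding r_def by linarith+
    have rn: "(M+1) * (r+1) + r \<le> n + 1"
    proof -
      have "a * (real r + 1) + real r \<le> a * (2 * log 2 (real n) + 2) + (2 * log 2 (real n) + 1)"
      proof (rule add_mono)
        show "a * (real r + 1) \<le> a * (2 * log 2 (real n) + 2)"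
          using r by (intro mult_left_mono) (auto simp: a_def)
      qed (use r in simp)
      also have "\<dots> \<le> real n" using elim by simp
      finally have "real ((M+1) * (r+1) + r) \<le> real n" by (simp add: a_def algebra_simps)
      then show ?thesis by linarith
    qed
    have "2 ^ n \<le> (real n + 1) * N"
      using of_nat_mono[OF power2_le_central_binomial[of n], where 'a=real]
      by (simp add: N_def algebra_simps)
    then have N: "2 ^ n / (real n + 1) \<le> N" by (simp add: field_simps)
    have fact: "fact n \<le> exp (C * N)"
    proof -
      have "fact n \<le> real (n ^ n)" by (rule fact_le_power)
      also have "\<dots> = real n ^ n" by simp
      also have "\<dots> = exp (real n * ln (real n))" using elim by (simp add: exp_of_nat_mult)
      also have "\<dots> \<le> exp (C * N)"
        using elim mult_left_mono[OF N, of C] C by simp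
      finally show ?thesis .
    qed
    have tail: "2 ^ (2 ^ (n-r)) \<le> exp (C * N)"
    proof -
      have "(real n)\<^sup>2 = 2 powr (2 * log 2 (real n))"
        using elim by (simp add: powr_powr[symmetric] powr_mult mult.commute[of 2] powr_numeral)
      also have "\<dots> \<le> 2 powr real r" using r by simp
      finally have n2: "(real n)\<^sup>2 \<le> 2 ^ r" by (simp add: powr_realpow)
      have "r \<le> n" using rn by simp
      then have "(2::real) ^ (n-r) = 2 ^ n / 2 ^ r" by (simp add: power_diff)
      also have "\<dots> \<le> 2 ^ n / (real n)\<^sup>2" using n2 elim by (intro divide_left_mono) auto
      also have "\<dots> \<le> C * (2 ^ n / (real n + 1))"
      proof -
        have "2 ^ n * (real n + 1) \<le> 2 ^ n * (C * (real n)\<^sup>2)"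
          using elim by (intro mult_left_mono) auto
        then show ?thesis using elim by (simp add: field_simps)
      qed
      also have "\<dots> \<le> C * N" using N C by (intro mult_left_mono) auto
      finally have "(2::real) ^ (n-r) \<le> C * N" .
      moreover have "(2::real) ^ (2 ^ (n-r)) \<le> exp 1 ^ (2 ^ (n-r))"
        using exp_ge_add_one_self[of 1] by (intro power_mono) auto
      moreover have "exp 1 ^ (2 ^ (n-r)) = exp ((2::real) ^ (n-r))"
        by (simp add: exp_of_nat_mult[symmetric])
      ultimately have "(2::real) ^ (2 ^ (n-r)) \<le> exp (2 ^ (n-r))" "exp ((2::real) ^ (n-r)) \<le> exp (C * N)"
        by simp_all
      then show ?thesis by (rule order_trans)
    qed
    have "real (forb_star n P) \<le> fact n * (exp (256 * C * N) * 2 ^ (2 ^ (n-r)))"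
      unfolding N_def using assms(4) C rn by (intro forb_star_le_if_large[where M=M]) (auto simp: M_def)
    also have "\<dots> \<le> exp (C * N) * (exp (256 * C * N) * exp (C * N))"
      using fact tail by (intro mult_mono) auto
    also have "\<dots> = exp (258 * (C * N))" by (simp add: exp_add[symmetric])
    also have "\<dots> \<le> exp (490 * K * (C * N))"
    proof -
      have "258 * (C * N) \<le> (490 * K) * (C * N)"
        using K C by (intro mult_right_mono) (auto simp: N_def)
      then show ?thesis by simp
    qed
    finally show ?case by (simp add: N_def ac_simps)
  qed
  then show ?thesis unfolding K_def eventually_sequentially .
qed

end
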